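(* Let $R>0$ and let $S\subset\mathbb{R}^2$ be a compact set whose volume function satisfies $$V(r;S)=\mu(S)+L_0 r+\pi r^2,\qquad 0\le r<R.$$ Let $D_1,\dots,D_n$ be an i.i.d. sample of the distance variable $D=\mathcal{D}(X,S)$, where $X$ is uniformly distributed on $B(S,R)\setminus S$, and let $\bar D=\frac1n\sum_{i=1}^n D_i$. Then the estimator of $L_0$ by the method of moments, $$\tilde L_0=\frac{2\pi R}{3}\,\frac{2R-3\bar D}{2\bar D-R},$$ has an infinite expectation.
   Context: For $x\in\mathbb{R}^2$, $\mathcal{D}(x,S)=\inf_{y\in S}\|x-y\|$ is the Euclidean distance to $S$; $B(S,r)=\{x:\mathcal{D}(x,S)\le r\}$ is the closed $r$-parallel set; $\mu$ is Lebesgue measure on $\mathbb{R}^2$; $V(r;S)=\mu(B(S,r))$ is the volume function of $S$. The coefficient $L_0$ is the unknown parameter to be estimated (the boundary measure of $S$), and $R$ is a fixed constant. *)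

theory Defs
  imports "HOL-Probability.Probability"
begin

text \<open>
  \<^const>\<open>infdist\<close> is \<open>0\<close> on the empty set, so \<open>parallel_set {} r\<close> is the whole plane rather than
  empty. Its \<^const>\<open>measure\<close> is \<open>0\<close>, so the empty set never has the volume function
  \<open>L0 * r + pi * r\<^sup>2\<close> on an interval \<open>0 \<le> r < R\<close> with \<open>R > 0\<close>.
\<close>

definition parallel_set :: "(real ^ 2) set \<Rightarrow> real \<Rightarrow> (real ^ 2) set" where
  "parallel_set S r = {x. infdist x S \<le> r}"

definition volume_function :: "(real ^ 2) set \<Rightarrow> real \<Rightarrow> real" where
  "volume_function S r = measure lborel (parallel_set S r)"

definition sample_mean :: "nat \<Rightarrow> (nat \<Rightarrow> 'a \<Rightarrow> real) \<Rightarrow> 'a \<Rightarrow> real" where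
  "sample_mean n D \<omega> = (\<Sum>i=1..n. D i \<omega>) / real n"

text \<open>
  If \<open>V(r) = V(0) + L0 * r + pi * r\<^sup>2\<close>, the distance variable has density proportional to
  \<open>L0 + 2 * pi * r\<close> on \<open>(0, R)\<close> and hence mean \<open>R * (3 * L0 + 4 * pi * R) / (6 * (L0 + pi * R))\<close>.
  Equating this mean with \<open>m\<close> and solving for \<open>L0\<close> gives the estimator below. At \<open>m = R / 2\<close>,
  where it is mathematically undefined, it has the value \<open>0\<close>.
\<close>

definition moment_estimator :: "real \<Rightarrow> real \<Rightarrow> real" where
  "moment_estimator R m = 2 * pi * R / 3 * ((2 * R - 3 * m) / (2 * m - R))"

text \<open>
  The expectation is infinite in the sense \<open>E |Y| = \<infinity>\<close>; for variables of both signs this does not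
  mean that the expectation exists as an extended real number.
\<close>

definition infinite_expectation :: "'a measure \<Rightarrow> ('a \<Rightarrow> real) \<Rightarrow> bool" where
  "infinite_expectation M Y \<longleftrightarrow>
     Y \<in> borel_measurable M \<and> (\<integral>\<^sup>+ \<omega>. ennreal \<bar>Y \<omega>\<bar> \<partial>M) = \<infinity>"

end

theory Submission
  imports Defs
begin

text \<open>
  The law of \<open>D\<close> gives every interval \<open>(a, b]\<close> with \<open>R / 4 \<le> a < b < R\<close> a mass of at least a constant
  times \<open>b - a\<close>. Conditionally on \<open>D\<^sub>2, \<dots>, D\<^sub>n\<close> all lying near \<open>R / 2\<close>, an event of positive
  probability, the estimator as a function of \<open>D\<^sub>1\<close> has a simple pole in \<open>(R / 4, 3 * R / 4)\<close>, which is
  not integrable against such a law.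
\<close>

text \<open>The right neighbourhood of \<open>p\<close> splits into dyadic shells. On the
  \<open>j\<close>-th shell the lower bound for \<open>f\<close> doubles with each step while the
  guaranteed mass halves, so every shell contributes at least the same positive amount, and
  infinitely many disjoint shells give \<infinity>. Bounding the mass of intervals stands in for
  bounding a density, and one side of the pole suffices.\<close>

lemma nn_integral_pole_eq_top:
  fixes \<nu> :: "real measure" and f :: "real \<Rightarrow> ennreal" and c k p \<eta> :: real
  assumes sets: "sets \<nu> = sets borel" and f: "f \<in> borel_measurable borel"
    and pos: "0 < c" "0 < k" "0 < \<eta>"
    and mass: "\<And>a b. p < a \<Longrightarrow> a \<le> b \<Longrightarrow> b \<le> p + \<eta> \<Longrightarrow> ennreal (k * (b - a)) \<le> emeasure \<nu> {a<..b}"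
    and pole: "\<And>x. p < x \<Longrightarrow> x \<le> p + \<eta> \<Longrightarrow> ennreal (c / (x - p)) \<le> f x"
  shows "(\<integral>\<^sup>+x. f x \<partial>\<nu>) = \<infinity>"
proof -
  define A where "A = (\<lambda>j::nat. {p + \<eta> / 2 ^ Suc j <.. p + \<eta> / 2 ^ j})"
  have le: "\<eta> / 2 ^ j \<le> \<eta> / 2 ^ i" if "i \<le> j" for i j :: nat
    using pos that by (intro divide_left_mono power_increasing) auto
  have "A i \<inter> A j = {}" if "i < j" for i j
    using le[of "Suc i" j] that by (auto simp: A_def)
  then have disj: "disjoint_family A"
    unfolding disjoint_family_on_def by (metis inf_commute linorder_neqE_nat)
  have A_sets: "A j \<in> sets \<nu>" for j
    by (simp add: A_def sets)
  have f': "f \<in> borel_measurable \<nu>"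
    using f sets by (simp cong: measurable_cong_sets)
  have piece: "ennreal (c * k / 2) \<le> (\<integral>\<^sup>+x\<in>A j. f x \<partial>\<nu>)" for j
  proof -
    let ?e = "\<eta> / 2 ^ j"
    have e: "0 < ?e" "?e \<le> \<eta>"
      using pos le[of 0 j] by auto
    \<comment> \<open>The shell has length \<open>?e / 2\<close>, so the product of the height
      \<open>c / ?e\<close> with \<open>k\<close> times this length does not depend on
      \<open>j\<close>.\<close>
    have "ennreal (c * k / 2) = ennreal (c / ?e) * ennreal (k * ((p + ?e) - (p + \<eta> / 2 ^ Suc j)))"
      using pos by (subst ennreal_mult[symmetric]) (auto simp: field_simps)
    also have "\<dots> \<le> ennreal (c / ?e) * emeasure \<nu> (A j)"
      using e pos unfolding A_def by (intro mult_left_mono mass) (auto intro!: divide_left_mono)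
    also have "\<dots> = (\<integral>\<^sup>+x. ennreal (c / ?e) * indicator (A j) x \<partial>\<nu>)"
      using A_sets by (simp add: nn_integral_cmult_indicator)
    also have "\<dots> \<le> (\<integral>\<^sup>+x\<in>A j. f x \<partial>\<nu>)"
    proof (intro nn_integral_mono)
      fix x
      show "ennreal (c / ?e) * indicator (A j) x \<le> f x * indicator (A j) x"
      proof (cases "x \<in> A j")
        case True
        have "0 < \<eta> / 2 ^ Suc j" using pos by simp
        with True have x: "p < x" "x \<le> p + ?e" unfolding A_def by auto
        then have "ennreal (c / ?e) \<le> ennreal (c / (x - p))"
          using pos e by (intro ennreal_leI divide_left_mono) auto
        also have "\<dots> \<le> f x" using x e by (intro pole) auto
        finally show ?thesis using True by simp
      qed simp
    qed
    finally show ?thesis .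
  qed
  have "of_nat m * ennreal (c * k / 2) \<le> (\<integral>\<^sup>+x. f x \<partial>\<nu>)" for m
  proof -
    have "of_nat m * ennreal (c * k / 2) \<le> (\<Sum>j<m. \<integral>\<^sup>+x\<in>A j. f x \<partial>\<nu>)"
      using sum_mono[of "{..<m}", OF piece] by simp
    also have "\<dots> \<le> (\<Sum>j. \<integral>\<^sup>+x\<in>A j. f x \<partial>\<nu>)"
      by (rule sum_le_suminf) auto
    also have "\<dots> = (\<integral>\<^sup>+x\<in>(\<Union>j. A j). f x \<partial>\<nu>)"
      using f' A_sets disj by (intro nn_integral_disjoint_family[symmetric]) auto
    also have "\<dots> \<le> (\<integral>\<^sup>+x. f x \<partial>\<nu>)"
      by (intro nn_integral_mono) (auto simp: indicator_def)
    finally show ?thesis .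
  qed
  moreover have "(SUP m. of_nat m * ennreal (c * k / 2)) = \<infinity>"
    using pos by (simp add: SUP_mult_right_ennreal[symmetric] ennreal_SUP_of_nat_eq_top ennreal_top_mult)
  ultimately show ?thesis
    by (metis SUP_least infinity_ennreal_def top.extremum_uniqueI)
qed

text \<open>The shell between the distances \<open>a\<close> and \<open>b\<close> has area V(b) -
  V(a) = (L0 + pi (a + b)) (b - a). Since L0 turns out to be nonnegative and a + b is at least R /
  2, the first factor is at least pi R / 2. Dividing by the area of
  \<open>parallel_set S R - S\<close> gives \<open>k\<close>.\<close>

lemma distance_law_mass:
  fixes S :: "(real ^ 2) set" and R L0 :: real
  assumes R: "0 < R" and S: "compact S"
    and V: "\<And>r. 0 \<le> r \<Longrightarrow> r < R \<Longrightarrow> volume_function S r = measure lborel S + L0 * r + pi * r\<^sup>2"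
  obtains k where "0 < k"
    "\<And>a b. R / 4 \<le> a \<Longrightarrow> a \<le> b \<Longrightarrow> b < R \<Longrightarrow> ennreal (k * (b - a)) \<le>
      emeasure (uniform_measure lborel (parallel_set S R - S)) {x. a < infdist x S \<and> infdist x S \<le> b}"
proof -
  \<comment> \<open>The parallel sets of the empty set are the whole plane, whose real-valued
    \<open>measure\<close> is 0 by default. Nonemptiness is what makes the parallel sets compact
    below.\<close>
  have ne: "S \<noteq> {}"
  proof
    assume "S = {}"
    then have V0: "measure lborel (parallel_set S r) = 0" for r
      by (simp add: parallel_set_def infdist_def measure_def)
    have "L0 * (R / 2) + pi * (R / 2)\<^sup>2 = 0" "L0 * (R / 4) + pi * (R / 4)\<^sup>2 = 0"
      using V[of "R / 2"] V[of "R / 4"] R V0 \<open>S = {}\<close> by (auto simp: volume_function_def)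
    \<comment> \<open>The coefficients 8 and 16 cancel \<open>L0\<close> between the volumes at R /
      2 and R / 4.\<close>
    moreover have "pi * R\<^sup>2 = 8 * (L0 * (R / 2) + pi * (R / 2)\<^sup>2) - 16 * (L0 * (R / 4) + pi * (R / 4)\<^sup>2)"
      by (simp add: power2_eq_square field_simps)
    ultimately have "pi * R\<^sup>2 = 0" by simp
    with R show False by simp
  qed
  have compact: "compact (parallel_set S r)" if "0 < r" for r
    unfolding parallel_set_def using S ne that by (intro compact_infdist_le)
  have fin: "emeasure lborel (parallel_set S r) < \<infinity>" if "0 < r" for r
    using compact[OF that] by (intro emeasure_bounded_finite compact_imp_bounded)
  have meas: "parallel_set S r \<in> sets lborel" if "0 < r" for r
    using compact[OF that] by (simp add: borel_compact)
  have S_sub: "S \<subseteq> parallel_set S r" if "0 < r" for r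
    using that by (auto simp: parallel_set_def)
  have vol: "measure lborel (parallel_set S r) = measure lborel S + L0 * r + pi * r\<^sup>2"
    if "0 < r" "r < R" for r
    using V[of r] that by (simp add: volume_function_def)
  \<comment> \<open>A negative \<open>L0\<close> would make the volume decrease below that of
    \<open>S\<close> for small radii. The witness \<open>r\<close> satisfies pi r \<le> - L0 / 2, so
    that L0 + pi r would still be negative.\<close>
  have L0: "0 \<le> L0"
  proof (rule ccontr)
    assume neg: "\<not> 0 \<le> L0"
    define r where "r = min (R / 2) (- L0 / (2 * pi))"
    have r: "0 < r" "r < R" "r \<le> - L0 / (2 * pi)"
      using neg R by (auto simp: r_def divide_neg_pos)
    have "measure lborel S \<le> measure lborel (parallel_set S r)"
      using S r fin meas S_sub by (intro measure_mono_fmeasurable) (auto simp: fmeasurable_def borel_compact)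
    then have "0 \<le> r * (L0 + pi * r)"
      using vol[OF r(1,2)] by (simp add: algebra_simps power2_eq_square)
    then have "0 \<le> L0 + pi * r"
      using r by (simp add: zero_le_mult_iff)
    moreover have "pi * r \<le> - L0 / 2"
      using r(3) by (simp add: field_simps)
    ultimately show False using neg by simp
  qed
  define U where "U = parallel_set S R - S"
  define B where "B = (\<lambda>a b. {x. a < infdist x S \<and> infdist x S \<le> b})"
  have U: "U \<in> sets lborel"
    unfolding U_def using meas R S by (auto simp: borel_compact)
  have U_fin: "emeasure lborel U < \<infinity>"
    unfolding U_def by (rule le_less_trans[OF emeasure_mono fin[OF R]]) (use meas R in auto)
  have B_mass: "ennreal (pi * R / 2 * (b - a)) \<le> emeasure lborel (U \<inter> B a b)"
    and B_sets: "B a b \<in> sets lborel"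
    if "R / 4 \<le> a" "a \<le> b" "b < R" for a b
  proof -
    have ab: "0 < a" "0 < b" "a < R" using R that by auto
    have B: "B a b = parallel_set S b - parallel_set S a"
      by (auto simp: B_def parallel_set_def)
    then show "B a b \<in> sets lborel" using meas ab by auto
    have "B a b \<subseteq> U"
      using that ab by (auto simp: B_def U_def parallel_set_def)
    then have "emeasure lborel (U \<inter> B a b) = emeasure lborel (parallel_set S b - parallel_set S a)"
      by (simp add: B Int_absorb1)
    also have "\<dots> = emeasure lborel (parallel_set S b) - emeasure lborel (parallel_set S a)"
      using fin[of a] meas ab that by (intro emeasure_Diff) (auto simp: parallel_set_def)
    also have "\<dots> = ennreal (measure lborel (parallel_set S b) - measure lborel (parallel_set S a))"
      using fin[of a] fin[of b] ab by (simp add: emeasure_eq_ennreal_measure ennreal_minus)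
    also have "measure lborel (parallel_set S b) - measure lborel (parallel_set S a) =
        (L0 + pi * (a + b)) * (b - a)"
      using vol[of a] vol[of b] ab that by (simp add: algebra_simps power2_eq_square)
    finally have eq: "emeasure lborel (U \<inter> B a b) = ennreal ((L0 + pi * (a + b)) * (b - a))" .
    have "pi * (R / 2) \<le> pi * (a + b)"
      using that by (intro mult_left_mono) auto
    then have "pi * R / 2 * (b - a) \<le> (L0 + pi * (a + b)) * (b - a)"
      using L0 that by (intro mult_right_mono) linarith+
    then show "ennreal (pi * R / 2 * (b - a)) \<le> emeasure lborel (U \<inter> B a b)"
      unfolding eq by (rule ennreal_leI)
  qed
  define c where "c = measure lborel U"
  have c_eq: "emeasure lborel U = ennreal c"
    using U_fin by (simp add: c_def emeasure_eq_ennreal_measure)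
  \<comment> \<open>The volume formula is assumed only for radii below \<open>R\<close>, so the area
    of \<open>U\<close> is not computed. It is positive because \<open>U\<close> contains a shell of
    positive area.\<close>
  have "0 < ennreal (pi * R / 2 * (R / 2 - R / 4))"
    using R by simp
  also have "\<dots> \<le> emeasure lborel (U \<inter> B (R / 4) (R / 2))"
    using R by (intro B_mass) auto
  also have "\<dots> \<le> ennreal c"
    unfolding c_eq[symmetric] using U by (intro emeasure_mono) auto
  finally have c: "0 < c" by simp
  show ?thesis
  proof
    show "0 < pi * R / 2 / c" using R c by simp
    fix a b assume ab: "R / 4 \<le> a" "a \<le> b" "b < R"
    have "ennreal (pi * R / 2 / c * (b - a)) = ennreal (pi * R / 2 * (b - a)) / ennreal c"
      using c R ab by (subst divide_ennreal) auto
    also have "\<dots> \<le> emeasure lborel (U \<inter> B a b) / ennreal c"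
      by (intro divide_right_mono_ennreal B_mass ab)
    also have "\<dots> = emeasure (uniform_measure lborel U) (B a b)"
      using U B_sets[OF ab] by (simp add: c_eq)
    finally show "ennreal (pi * R / 2 / c * (b - a)) \<le>
      emeasure (uniform_measure lborel (parallel_set S R - S)) {x. a < infdist x S \<and> infdist x S \<le> b}"
      unfolding U_def B_def .
  qed
qed

text \<open>Here d is the distance of one observation from the pole, and q is the sample size, which
  divides the deviation of the mean from R / 2. As m - R / 2 is at most d and d at most R / 8, the
  numerator 2 R - 3 m = R / 2 - 3 (m - R / 2) is at least R / 8 and the denominator is at most 2 d.
  The resulting constant is free of q.\<close>

lemma abs_moment_estimator_ge:
  fixes R d m :: real
  assumes R: "0 < R" and d: "0 < d" "d \<le> R / 8" and m: "m - R / 2 = d / q" and q: "1 \<le> q"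
  shows "pi * R\<^sup>2 / 24 / d \<le> \<bar>moment_estimator R m\<bar>"
proof -
  have le: "m - R / 2 \<le> d"
    unfolding m using d q by (simp add: divide_le_eq mult_le_cancel_left1)
  have pos: "0 < m - R / 2"
    unfolding m using d q by simp
  have "R / 8 / (2 * d) \<le> (2 * R - 3 * m) / (2 * m - R)"
    using le pos R d by (intro frac_le) auto
  then have "2 * pi * R / 3 * (R / 8 / (2 * d)) \<le> moment_estimator R m"
    unfolding moment_estimator_def using R by (intro mult_left_mono) auto
  moreover have "2 * pi * R / 3 * (R / 8 / (2 * d)) = pi * R\<^sup>2 / 24 / d"
    by (simp add: power2_eq_square)
  ultimately show ?thesis by linarith
qed

text \<open>If every variable lies within \<delta> / n of m, the n - 1 summands together deviate
  from (n - 1) m by at most \<delta>. By independence this happens with a probability that is a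
  product of positive factors. Constraining the first variable too only shrinks the event. For n = 1
  the sum is empty and the centre is 0.\<close>

lemma (in prob_space) indep_sum_concentrated:
  fixes D :: "nat \<Rightarrow> 'a \<Rightarrow> real"
  assumes indep: "indep_vars (\<lambda>_. borel) D {1..n}" and n: "1 \<le> n" and \<delta>: "0 < \<delta>"
    and pos: "\<And>i. i \<in> {1..n} \<Longrightarrow> 0 < prob (D i -` {m - \<delta> / n<..m + \<delta> / n} \<inter> space M)"
  shows "0 < prob ((\<lambda>\<omega>. \<Sum>i=2..n. D i \<omega>) -` {s. \<bar>s - (real n - 1) * m\<bar> \<le> \<delta>} \<inter> space M)"
proof -
  let ?I = "{m - \<delta> / n<..m + \<delta> / n}"
  have rv: "random_variable borel (D i)" if "i \<in> {1..n}" for i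
    using indep that by (auto simp: indep_vars_def)
  have "(\<lambda>\<omega>. \<Sum>i=2..n. D i \<omega>) \<in> borel_measurable M"
    using rv by (intro borel_measurable_sum) auto
  moreover have "{s. \<bar>s - (real n - 1) * m\<bar> \<le> \<delta>} \<in> sets borel"
    by measurable
  ultimately have meas: "(\<lambda>\<omega>. \<Sum>i=2..n. D i \<omega>) -` {s. \<bar>s - (real n - 1) * m\<bar> \<le> \<delta>} \<inter> space M \<in> events"
    by (rule measurable_sets)
  have "0 < (\<Prod>i=1..n. prob (D i -` ?I \<inter> space M))"
    using pos by (intro prod_pos) auto
  also have "\<dots> = prob (\<Inter>i\<in>{1..n}. D i -` ?I \<inter> space M)"
    using n by (intro indep_varsD_finite[OF indep, symmetric]) auto
  also have "\<dots> \<le> prob ((\<lambda>\<omega>. \<Sum>i=2..n. D i \<omega>) -` {s. \<bar>s - (real n - 1) * m\<bar> \<le> \<delta>} \<inter> space M)"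
  proof (intro finite_measure_mono meas subsetI)
    fix \<omega> assume \<omega>: "\<omega> \<in> (\<Inter>i\<in>{1..n}. D i -` ?I \<inter> space M)"
    have "(\<Sum>i=2..n. D i \<omega>) - (real n - 1) * m = (\<Sum>i=2..n. D i \<omega> - m)"
      using n by (simp add: sum_subtractf of_nat_diff)
    also have "\<bar>\<dots>\<bar> \<le> (\<Sum>i=2..n. \<delta> / n)"
    proof (intro sum_abs[THEN order_trans] sum_mono)
      fix i assume "i \<in> {2..n}"
      then have "D i \<omega> \<in> ?I" using \<omega> by auto
      then show "\<bar>D i \<omega> - m\<bar> \<le> \<delta> / n" by (auto simp: abs_le_iff)
    qed
    also have "\<dots> = (real n - 1) * (\<delta> / n)"
      using n by (simp add: of_nat_diff)
    also have "\<dots> \<le> \<delta>"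
      using n \<delta> by (simp add: field_simps of_nat_diff)
    finally show "\<omega> \<in> (\<lambda>\<omega>. \<Sum>i=2..n. D i \<omega>) -` {s. \<bar>s - (real n - 1) * m\<bar> \<le> \<delta>} \<inter> space M"
      using \<omega> n by auto
  qed
  finally show ?thesis .
qed

theorem proposition4:
  fixes S :: "(real ^ 2) set"
    and R L0 :: real
    and N :: "'b measure"
    and X :: "'b \<Rightarrow> real ^ 2"
    and M :: "'a measure"
    and D :: "nat \<Rightarrow> 'a \<Rightarrow> real"
    and n :: nat
  assumes "R > 0"
    and "compact S"
    and "\<And>r. 0 \<le> r \<Longrightarrow> r < R \<Longrightarrow> volume_function S r = measure lborel S + L0 * r + pi * r\<^sup>2"
    and "prob_space N"
    and "X \<in> measurable N lborel"
    and "distr N lborel X = uniform_measure lborel (parallel_set S R - S)"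
    and "prob_space M"
    and "n \<ge> 1"
    and "prob_space.indep_vars M (\<lambda>_. borel) D {1..n}"
    and "\<And>i. i \<in> {1..n} \<Longrightarrow> distr M borel (D i) = distr N borel (\<lambda>\<omega>. infdist (X \<omega>) S)"
  shows "infinite_expectation M (\<lambda>\<omega>. moment_estimator R (sample_mean n D \<omega>))"
proof -
  interpret M: prob_space M by fact
  note R = assms(1) and n = \<open>n \<ge> 1\<close> and indep = assms(9)
  define \<nu> where "\<nu> = distr N borel (\<lambda>\<omega>. infdist (X \<omega>) S)"
  have inf_meas: "(\<lambda>x. infdist x S) \<in> borel_measurable borel"
    by (intro borel_measurable_continuous_onI continuous_intros)
  obtain k where k: "0 < k" and mass0: "\<And>a b. R / 4 \<le> a \<Longrightarrow> a \<le> b \<Longrightarrow> b < R \<Longrightarrow> ennreal (k * (b - a)) \<le>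
      emeasure (uniform_measure lborel (parallel_set S R - S)) {x. a < infdist x S \<and> infdist x S \<le> b}"
    using distance_law_mass[OF assms(1-3)] by blast
  have mass: "ennreal (k * (b - a)) \<le> emeasure \<nu> {a<..b}" if "R / 4 \<le> a" "a \<le> b" "b < R" for a b
  proof -
    \<comment> \<open>Factoring through the law of \<open>X\<close> turns the mass of an interval
      under \<open>\<nu>\<close> into the mass of a shell under the uniform measure.\<close>
    have "\<nu> = distr (distr N lborel X) borel (\<lambda>x. infdist x S)"
      unfolding \<nu>_def using assms(5) inf_meas by (subst distr_distr) (auto simp: comp_def)
    then have "emeasure \<nu> {a<..b} =
        emeasure (uniform_measure lborel (parallel_set S R - S)) ((\<lambda>x. infdist x S) -` {a<..b})"
      using inf_meas by (simp add: assms(6) emeasure_distr)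
    also have "(\<lambda>x. infdist x S) -` {a<..b} = {x. a < infdist x S \<and> infdist x S \<le> b}"
      by auto
    finally show ?thesis using mass0[OF that] by simp
  qed
  have law: "distr M borel (D i) = \<nu>" if "i \<in> {1..n}" for i
    using assms(10)[OF that] by (simp add: \<nu>_def)
  have rv: "D i \<in> borel_measurable M" if "i \<in> {1..n}" for i
    using indep that by (auto simp: M.indep_vars_def)

  define T where "T = (\<lambda>\<omega>. \<Sum>i=2..n. D i \<omega>)"
  \<comment> \<open>The estimator is viewed as a function of the first observation and the sum of
    the others. Its absolute value is nonnegative, so the two can be integrated in either
    order.\<close>
  define g where "g = (\<lambda>(x, t). ennreal \<bar>moment_estimator R ((x + t) / n)\<bar>)"
  have g: "g \<in> borel_measurable (borel \<Otimes>\<^sub>M borel)"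
    unfolding g_def moment_estimator_def by measurable
  have idx: "{1..n} = insert 1 {2..n}" using n by auto
  have est: "ennreal \<bar>moment_estimator R (sample_mean n D \<omega>)\<bar> = g (D 1 \<omega>, T \<omega>)" for \<omega>
    unfolding g_def sample_mean_def T_def idx by simp
  have indep1: "M.indep_var borel (D 1) borel T"
    unfolding T_def using indep idx by (intro M.indep_vars_sum) auto
  then have rvs: "D 1 \<in> borel_measurable M" "T \<in> borel_measurable M"
    and joint: "distr M borel (D 1) \<Otimes>\<^sub>M distr M borel T =
      distr M (borel \<Otimes>\<^sub>M borel) (\<lambda>\<omega>. (D 1 \<omega>, T \<omega>))"
    by (auto simp: M.indep_var_distribution_eq)
  define \<tau> where "\<tau> = distr M borel T"
  have joint': "\<nu> \<Otimes>\<^sub>M \<tau> = distr M (borel \<Otimes>\<^sub>M borel) (\<lambda>\<omega>. (D 1 \<omega>, T \<omega>))"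
    using joint law[of 1] n by (simp add: \<tau>_def)
  interpret \<nu>: prob_space \<nu>
    using law[of 1] n M.prob_space_distr[OF rvs(1)] by simp
  interpret \<tau>: prob_space \<tau>
    unfolding \<tau>_def by (rule M.prob_space_distr[OF rvs(2)])
  interpret P: pair_sigma_finite \<nu> \<tau> ..
  have sets: "sets \<nu> = sets borel" "sets \<tau> = sets borel"
    by (simp_all add: \<nu>_def \<tau>_def)

  \<comment> \<open>The pole in the first observation is n R / 2 - t. For t in \<open>J\<close> it
    is within R / 8 of R / 2, so the interval of length R / 8 to its right stays inside
    [3 R / 8, 3 R / 4], where the mass bound holds.\<close>
  define J where "J = {s. \<bar>s - (real n - 1) * (R / 2)\<bar> \<le> R / 8}"
  have J: "J \<in> sets borel" unfolding J_def by measurable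
  have inner: "(\<integral>\<^sup>+x. g (x, t) \<partial>\<nu>) = \<infinity>" if "t \<in> J" for t
  proof (rule nn_integral_pole_eq_top)
    let ?p = "n * R / 2 - t"
    have p: "R / 4 \<le> ?p" "?p + R / 8 < R"
      using that R unfolding J_def mem_Collect_eq abs_le_iff by (simp_all add: field_simps)
    show "sets \<nu> = sets borel" by fact
    show "(\<lambda>x. g (x, t)) \<in> borel_measurable borel"
      unfolding g_def moment_estimator_def prod.case by measurable
    show "0 < pi * R\<^sup>2 / 24" "0 < k" "0 < R / 8" using R k by auto
    show "ennreal (k * (b - a)) \<le> emeasure \<nu> {a<..b}"
      if "?p < a" "a \<le> b" "b \<le> ?p + R / 8" for a b
      using that p by (intro mass) linarith+
    \<comment> \<open>Only points strictly to the right of the pole are used, so the default value 0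
      of the estimator at mean R / 2 does no harm.\<close>
    show "ennreal (pi * R\<^sup>2 / 24 / (x - ?p)) \<le> g (x, t)" if x: "?p < x" "x \<le> ?p + R / 8" for x
    proof -
      have m: "(x + t) / n - R / 2 = (x - ?p) / n"
        using n by (simp add: field_simps)
      then have "pi * R\<^sup>2 / 24 / (x - ?p) \<le> \<bar>moment_estimator R ((x + t) / n)\<bar>"
        using R x n by (intro abs_moment_estimator_ge[OF _ _ _ m]) (linarith | simp)+
      then show ?thesis by (simp add: g_def ennreal_leI)
    qed
  qed
  have "0 < M.prob (T -` J \<inter> space M)"
    unfolding T_def J_def
  proof (rule M.indep_sum_concentrated[OF indep n])
    show "0 < R / 8" using R by simp
    fix i assume i: "i \<in> {1..n}"
    let ?h = "R / 8 / n"
    \<comment> \<open>The bound R / 8 keeps the interval around R / 2 inside the range of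
      \<open>mass\<close>.\<close>
    have h: "0 < ?h" "?h \<le> R / 8" using R n by (auto simp: divide_le_eq mult_le_cancel_left1)
    have "0 < ennreal (k * ((R / 2 + ?h) - (R / 2 - ?h)))"
      using k h by (subst ennreal_less_zero_iff) (intro mult_pos_pos, linarith+)
    also have "\<dots> \<le> emeasure \<nu> {R / 2 - ?h<..R / 2 + ?h}"
      using h R by (intro mass) auto
    also have "\<dots> = emeasure M (D i -` {R / 2 - ?h<..R / 2 + ?h} \<inter> space M)"
      unfolding law[OF i, symmetric] using rv[OF i] by (intro emeasure_distr) auto
    finally show "0 < M.prob (D i -` {R / 2 - ?h<..R / 2 + ?h} \<inter> space M)"
      by (simp add: M.emeasure_eq_measure)
  qed
  then have J_pos: "0 < emeasure \<tau> J"
    unfolding \<tau>_def using J rvs by (simp add: emeasure_distr M.emeasure_eq_measure)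

  \<comment> \<open>The inner integral is infinite on a set of positive
    \<open>\<tau>\<close>-measure, which forces the double integral, and by independence the
    expectation, to be infinite.\<close>
  have "\<infinity> = (\<integral>\<^sup>+t. \<infinity> * indicator J t \<partial>\<tau>)"
    using J sets J_pos by (subst nn_integral_cmult_indicator) (auto simp: ennreal_top_mult)
  also have "\<dots> \<le> (\<integral>\<^sup>+t. (\<integral>\<^sup>+x. g (x, t) \<partial>\<nu>) \<partial>\<tau>)"
    by (intro nn_integral_mono) (auto simp: indicator_def inner)
  also have "\<dots> = integral\<^sup>N (\<nu> \<Otimes>\<^sub>M \<tau>) g"
    using g sets by (intro P.nn_integral_snd) (simp cong: measurable_cong_sets sets_pair_measure_cong)
  also have "\<dots> = (\<integral>\<^sup>+\<omega>. g (D 1 \<omega>, T \<omega>) \<partial>M)"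
    unfolding joint' using g rvs by (intro nn_integral_distr) auto
  finally have "(\<integral>\<^sup>+\<omega>. ennreal \<bar>moment_estimator R (sample_mean n D \<omega>)\<bar> \<partial>M) = \<infinity>"
    unfolding est by (simp add: top.extremum_unique)
  moreover have "(\<lambda>\<omega>. moment_estimator R (sample_mean n D \<omega>)) \<in> borel_measurable M"
    unfolding moment_estimator_def sample_mean_def
    using rv by (intro borel_measurable_times borel_measurable_divide borel_measurable_diff
        borel_measurable_sum borel_measurable_const) auto
  ultimately show ?thesis
    unfolding infinite_expectation_def by simp
qed

end
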